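(* Let $A \in \mathbb{R}^{M\times N}$ with spectral norm $\|A\|_2 < 1$, let $b \in \mathbb{R}^M$, and for each $k=1,\dots,N$ let $1 \le q_k \le 2$ and $\lambda_k > 0$. Let $$F(x) = \|Ax-b\|_2^2 + 2\sum_{k=1}^N \lambda_k |x_k|^{q_k}, \qquad x \in \mathbb{R}^N .$$ Let $\{x^n\}_{n\ge 0}$ be the sequence of IRLS iterates (defined in the context) generated from an arbitrary $x^0 \in \mathbb{R}^N$, $\epsilon_0>0$ and $\alpha \in (0,1)$. Then there is $\bar{x} \in \mathbb{R}^N$ with $F(\bar{x}) \le F(x)$ for all $x \in \mathbb{R}^N$ such that $$\lim_{n\to\infty} F(x^n) = F(\bar{x}).$$ In particular, every accumulation point $\hat{x}$ of $\{x^n\}$ satisfies $F(\hat{x}) = F(\bar{x})$; and if the minimizer $\bar{x}$ of $F$ is unique, then $x^n \to \bar{x}$ as $n \to\infty$.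
   Context: IRLS iterates: given $A$, $b$, $q_k$, $\lambda_k$, an initial $x^0\in\mathbb{R}^N$, $\epsilon_0>0$ and a fixed $\alpha\in(0,1)$, define for $n \ge 0$ the weights $$w^n_k = \frac{1}{\left[(x^n_k)^2 + \epsilon_n^2\right]^{\frac{2-q_k}{2}}}, \qquad k=1,\dots,N,$$ the iterates $$x^{n+1}_k = \frac{1}{1+\lambda_k q_k w^n_k}\left(x^n_k + (A^Tb)_k - (A^TAx^n)_k\right), \qquad k=1,\dots,N,$$ and, for $n \ge 1$, $$\epsilon_n = \min\left(\epsilon_{n-1},\ \left(\|x^n - x^{n-1}\|_2 + \alpha^n\right)^{1/2}\right),$$ where $\alpha^n$ is the $n$-th power of $\alpha$. $\|A\|_2$ denotes the operator norm of $A$ from $\ell_2$ to $\ell_2$ (largest singular value). *)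

theory Defs
  imports "HOL-Analysis.Analysis"
begin

definition irls_objective ::
    "real ^ 'n ^ 'm \<Rightarrow> real ^ 'm \<Rightarrow> real ^ 'n \<Rightarrow> real ^ 'n \<Rightarrow> real ^ 'n \<Rightarrow> real"
  where "irls_objective A b q lam x =
    (norm (A *v x - b))\<^sup>2 + 2 * (\<Sum>k\<in>UNIV. lam $ k * \<bar>x $ k\<bar> powr (q $ k))"

definition irls_weight :: "real ^ 'n \<Rightarrow> real \<Rightarrow> real ^ 'n \<Rightarrow> 'n \<Rightarrow> real"
  where "irls_weight q e x k = 1 / ((x $ k)\<^sup>2 + e\<^sup>2) powr ((2 - q $ k) / 2)"

definition irls_step ::
    "real ^ 'n ^ 'm \<Rightarrow> real ^ 'm \<Rightarrow> real ^ 'n \<Rightarrow> real ^ 'n \<Rightarrow> real \<Rightarrow> real ^ 'n \<Rightarrow> real ^ 'n"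
  where "irls_step A b q lam e x =
    (\<chi> k. 1 / (1 + lam $ k * q $ k * irls_weight q e x k) *
       (x $ k + (transpose A *v b) $ k - (transpose A *v (A *v x)) $ k))"

text \<open>The iterates and the smoothing parameters are defined by simultaneous recursion, as
  the sequence of pairs \<open>(x\<^sup>n, \<epsilon>\<^sub>n)\<close>; the lemmas below give the two separate recursions.\<close>

primrec irls_state ::
    "real ^ 'n ^ 'm \<Rightarrow> real ^ 'm \<Rightarrow> real ^ 'n \<Rightarrow> real ^ 'n \<Rightarrow> real ^ 'n \<Rightarrow> real \<Rightarrow> real
      \<Rightarrow> nat \<Rightarrow> (real ^ 'n) \<times> real"
  where
    "irls_state A b q lam x0 e0 \<alpha> 0 = (x0, e0)"
  | "irls_state A b q lam x0 e0 \<alpha> (Suc n) =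
      (let (x, e) = irls_state A b q lam x0 e0 \<alpha> n;
           x' = irls_step A b q lam e x
       in (x', min e (sqrt (norm (x' - x) + \<alpha> ^ Suc n))))"

definition irls_iterate ::
    "real ^ 'n ^ 'm \<Rightarrow> real ^ 'm \<Rightarrow> real ^ 'n \<Rightarrow> real ^ 'n \<Rightarrow> real ^ 'n \<Rightarrow> real \<Rightarrow> real
      \<Rightarrow> nat \<Rightarrow> real ^ 'n"
  where "irls_iterate A b q lam x0 e0 \<alpha> n = fst (irls_state A b q lam x0 e0 \<alpha> n)"

definition irls_eps ::
    "real ^ 'n ^ 'm \<Rightarrow> real ^ 'm \<Rightarrow> real ^ 'n \<Rightarrow> real ^ 'n \<Rightarrow> real ^ 'n \<Rightarrow> real \<Rightarrow> real
      \<Rightarrow> nat \<Rightarrow> real"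
  where "irls_eps A b q lam x0 e0 \<alpha> n = snd (irls_state A b q lam x0 e0 \<alpha> n)"

lemma irls_iterate_0: "irls_iterate A b q lam x0 e0 \<alpha> 0 = x0"
  by (simp add: irls_iterate_def)

lemma irls_iterate_Suc:
  "irls_iterate A b q lam x0 e0 \<alpha> (Suc n) =
     irls_step A b q lam (irls_eps A b q lam x0 e0 \<alpha> n) (irls_iterate A b q lam x0 e0 \<alpha> n)"
  by (simp add: irls_iterate_def irls_eps_def Let_def split: prod.split)

lemma irls_eps_0: "irls_eps A b q lam x0 e0 \<alpha> 0 = e0"
  by (simp add: irls_eps_def)

lemma irls_eps_Suc:
  "irls_eps A b q lam x0 e0 \<alpha> (Suc n) =
     min (irls_eps A b q lam x0 e0 \<alpha> n)
       (sqrt (norm (irls_iterate A b q lam x0 e0 \<alpha> (Suc n) - irls_iterate A b q lam x0 e0 \<alpha> n)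
              + \<alpha> ^ Suc n))"
  by (simp add: irls_iterate_def irls_eps_def Let_def split: prod.split)

end

(* Replace |t|^r by its smoothing (t^2 + e^2)^(r/2) in F. For r <= 2 the smoothed objective at the
   current point is majorized, by concavity of s^(r/2), by a function that the IRLS step decreases
   by the square of the step length d_n; hence the smoothed values decrease to some L and d_n, eps_n
   tend to 0. For r >= 1 the smoothed objective is convex, and its gradient at x^n is
   O(d_n / eps_n). The recursion for eps_n forces liminf d_n / eps_n = 0, so L is at most, hence
   equal to, the infimum of F; no case distinction on vanishing limit components is needed. *)

theory Submission
  imports Defs
begin

section \<open>Tangent bounds and subadditivity of real powers\<close>

text \<open>Weighted AM-GM with weights \<open>p\<close> and \<open>1 - p\<close>, multiplied by
  \<open>t powr (p - 1)\<close>, is the tangent bound for a concave power.\<close>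

lemma powr_le_tangent:
  fixes s t p :: real
  assumes "0 < s" "0 < t" "0 \<le> p" "p \<le> 1"
  shows "s powr p \<le> t powr p + p * t powr (p - 1) * (s - t)"
proof -
  have "s powr p * t powr (1 - p) \<le> p * s + (1 - p) * t"
    using assms by (intro Youngs_inequality_0) auto
  then have "s powr p * t powr (1 - p) * t powr (p - 1) \<le> (p * s + (1 - p) * t) * t powr (p - 1)"
    by (intro mult_right_mono) auto
  moreover have "t powr (1 - p) * t powr (p - 1) = 1"
    using assms by (simp flip: powr_add)
  moreover have "t * t powr (p - 1) = t powr p"
    using assms by (simp add: powr_mult_base)
  ultimately show ?thesis by (simp add: algebra_simps del: mult_eq_1_iff mult_cancel_right1)
qed

text \<open>The inverse power \<open>1/r\<close> is concave, so its tangent bound at the points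
  \<open>s powr r\<close> and \<open>t powr r\<close> can be solved for
  \<open>s powr r\<close>.\<close>

lemma powr_ge_tangent:
  fixes s t r :: real
  assumes "0 < s" "0 < t" "1 \<le> r"
  shows "t powr r + r * t powr (r - 1) * (s - t) \<le> s powr r"
proof -
  have "(s powr r) powr (1/r)
      \<le> (t powr r) powr (1/r) + (1/r) * (t powr r) powr (1/r - 1) * (s powr r - t powr r)"
    using assms by (intro powr_le_tangent) auto
  moreover have "r * (1 / r - 1) = 1 - r" using assms by (simp add: field_simps)
  ultimately have "s \<le> t + (1/r) * t powr (1 - r) * (s powr r - t powr r)"
    using assms by (simp add: powr_powr)
  then have "r * t powr (r - 1) * (s - t)
      \<le> r * t powr (r - 1) * ((1/r) * t powr (1 - r) * (s powr r - t powr r))"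
    using assms by (intro mult_left_mono) auto
  also have "\<dots> = (t powr (r - 1) * t powr (1 - r)) * (s powr r - t powr r)"
    using assms by simp
  also have "t powr (r - 1) * t powr (1 - r) = 1"
    using assms by (simp flip: powr_add)
  finally show ?thesis by simp
qed

text \<open>As \<open>p - 1\<close> is nonpositive, each summand \<open>u\<close> satisfies
  \<open>u powr (p - 1) \<ge> (s + t) powr (p - 1)\<close>; multiply by \<open>u\<close> and add the
  two cases.\<close>

lemma powr_add_le:
  fixes s t p :: real
  assumes "0 \<le> s" "0 \<le> t" "0 \<le> p" "p \<le> 1"
  shows "(s + t) powr p \<le> s powr p + t powr p"
proof (cases "s = 0 \<or> t = 0")
  case False
  then have pos: "s > 0" "t > 0" using assms by auto
  have *: "u powr p \<ge> u * (s + t) powr (p - 1)" if "u > 0" "u \<le> s + t" for u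
  proof -
    have "(s + t) powr (p - 1) \<le> u powr (p - 1)"
      using that assms by (intro powr_mono2') auto
    then have "u * (s + t) powr (p - 1) \<le> u * u powr (p - 1)"
      using that by simp
    then show ?thesis using that by (simp add: powr_mult_base)
  qed
  have "(s + t) powr p = (s + t) * (s + t) powr (p - 1)"
    using pos by (simp add: powr_mult_base)
  also have "\<dots> \<le> s powr p + t powr p"
    using *[of s] *[of t] pos by (simp add: distrib_right)
  finally show ?thesis .
qed auto

lemma abs_powr_eq: "\<bar>t\<bar> powr r = (t\<^sup>2) powr (r / 2)" for t :: real
proof -
  have "t\<^sup>2 = \<bar>t\<bar> powr 2" by (simp add: powr_numeral)
  then show ?thesis by (simp only: powr_powr) simp
qed

section \<open>The smoothed power of one coordinate\<close>

definition smoothed_abs_powr :: "real \<Rightarrow> real \<Rightarrow> real \<Rightarrow> real"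
  where "smoothed_abs_powr r e t = (t\<^sup>2 + e\<^sup>2) powr (r / 2)"

lemma abs_powr_le_smoothed:
  assumes "0 \<le> r"
  shows "\<bar>t\<bar> powr r \<le> smoothed_abs_powr r e t"
proof -
  have "\<bar>t\<bar> powr r = (t\<^sup>2) powr (r / 2)"
    by (rule abs_powr_eq)
  also have "\<dots> \<le> (t\<^sup>2 + e\<^sup>2) powr (r / 2)"
    using assms by (intro powr_mono2) auto
  finally show ?thesis by (simp add: smoothed_abs_powr_def)
qed

lemma smoothed_le_abs_powr:
  assumes "0 \<le> r" "r \<le> 2"
  shows "smoothed_abs_powr r e t \<le> \<bar>t\<bar> powr r + \<bar>e\<bar> powr r"
  unfolding smoothed_abs_powr_def abs_powr_eq using assms by (intro powr_add_le) auto

text \<open>Concavity of u^(r/2) at u = s^2 + e^2. The term with e'^2 - e^2 is nonpositive and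
  dropped, so a single bound covers both the move to \<open>y\<close> and the decrease of the
  smoothing parameter.\<close>

lemma smoothed_abs_powr_majorant:
  assumes "0 < e'" "e' \<le> e" "0 \<le> r" "r \<le> 2"
  shows "2 * smoothed_abs_powr r e' y
    \<le> 2 * smoothed_abs_powr r e s + r * (s\<^sup>2 + e\<^sup>2) powr (r / 2 - 1) * (y\<^sup>2 - s\<^sup>2)"
proof -
  have pos: "0 < y\<^sup>2 + e'\<^sup>2" "0 < s\<^sup>2 + e\<^sup>2" "e'\<^sup>2 \<le> e\<^sup>2"
    using assms by (auto intro!: add_nonneg_pos power_mono)
  have "smoothed_abs_powr r e' y
      \<le> smoothed_abs_powr r e s
        + r / 2 * (s\<^sup>2 + e\<^sup>2) powr (r / 2 - 1) * (y\<^sup>2 + e'\<^sup>2 - (s\<^sup>2 + e\<^sup>2))"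
    unfolding smoothed_abs_powr_def using assms pos by (intro powr_le_tangent) auto
  also have "\<dots> \<le> smoothed_abs_powr r e s
        + r / 2 * (s\<^sup>2 + e\<^sup>2) powr (r / 2 - 1) * (y\<^sup>2 - s\<^sup>2)"
    using assms pos by (intro add_left_mono mult_left_mono) auto
  finally show ?thesis by simp
qed

text \<open>Convexity: the smoothed power is the \<open>r\<close>-th power of the Euclidean norm of
  (t, e). The slope of that norm is handled by Cauchy-Schwarz, the outer power by its
  tangent.\<close>

lemma smoothed_abs_powr_tangent:
  assumes "0 < e" "1 \<le> r"
  shows "smoothed_abs_powr r e s + r * (s\<^sup>2 + e\<^sup>2) powr (r / 2 - 1) * s * (z - s)
    \<le> smoothed_abs_powr r e z"
proof -
  define u v where "u = sqrt (z\<^sup>2 + e\<^sup>2)" and "v = sqrt (s\<^sup>2 + e\<^sup>2)"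
  have sq: "0 < z\<^sup>2 + e\<^sup>2" "0 < s\<^sup>2 + e\<^sup>2"
    using assms by (auto intro!: add_nonneg_pos)
  then have pos: "0 < u" "0 < v" by (auto simp: u_def v_def)
  have powr_sqrt: "sqrt a powr c = a powr (c / 2)" if "0 < a" for a c :: real
    using that by (simp add: powr_powr flip: powr_half_sqrt)
  \<comment> \<open>Cauchy-Schwarz for (s, e) and (z, e); the defect of the squares is exactly
    \<open>(e * (s - z))\<^sup>2\<close>.\<close>
  have "s * z + e * e \<le> v * u"
  proof (rule power2_le_imp_le)
    have "(v * u)\<^sup>2 - (s * z + e * e)\<^sup>2 = (s\<^sup>2 + e\<^sup>2) * (z\<^sup>2 + e\<^sup>2) - (s * z + e * e)\<^sup>2"
      using sq by (simp add: u_def v_def power_mult_distrib)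
    also have "\<dots> = (e * (s - z))\<^sup>2" by (simp add: power2_eq_square algebra_simps)
    finally show "(s * z + e * e)\<^sup>2 \<le> (v * u)\<^sup>2"
      using zero_le_power2[of "e * (s - z)"] by linarith
  qed (use pos in simp)
  moreover have "v * v = s * s + e * e" using sq by (simp add: v_def power2_eq_square)
  ultimately have "s * (z - s) \<le> v * (u - v)" by (simp add: algebra_simps)
  then have "r * (v powr (r - 2) * (s * (z - s))) \<le> r * (v powr (r - 2) * (v * (u - v)))"
    using assms by (intro mult_left_mono) auto
  also have "v powr (r - 2) * (v * (u - v)) = v powr (r - 1) * (u - v)"
    using pos powr_mult_base[of v "r - 2"] by (simp add: mult.commute)
  finally have "v powr r + r * v powr (r - 2) * s * (z - s) \<le> u powr r"
    using powr_ge_tangent[of u v r] pos assms unfolding mult.assoc by linarith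
  then show ?thesis using sq
    by (simp add: u_def v_def smoothed_abs_powr_def powr_sqrt diff_divide_distrib)
qed

section \<open>Accumulation points of bounded minimizing sequences\<close>

text \<open>Otherwise a subsequence stays at distance at least \<open>e\<close> from
  \<open>l\<close>, yet by compactness it has a convergent subsequence, whose limit must be
  \<open>l\<close>.\<close>

lemma bounded_seq_tendsto_unique_accumulation_point:
  fixes x :: "nat \<Rightarrow> 'a::heine_borel"
  assumes "bounded (range x)"
    and "\<And>r l'. strict_mono r \<Longrightarrow> (x \<circ> r) \<longlonglongrightarrow> l' \<Longrightarrow> l' = l"
  shows "x \<longlonglongrightarrow> l"
proof (rule ccontr)
  assume "\<not> x \<longlonglongrightarrow> l"
  then obtain e where "e > 0" and e: "\<And>N. \<exists>n\<ge>N. e \<le> dist (x n) l"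
    unfolding lim_sequentially by (meson not_le)
  then have "infinite {n. e \<le> dist (x n) l}"
    unfolding infinite_nat_iff_unbounded_le by auto
  then obtain r :: "nat \<Rightarrow> nat" where r: "strict_mono r" "\<And>n. e \<le> dist (x (r n)) l"
    using infinite_enumerate by blast
  have "bounded (range (x \<circ> r))"
    using assms(1) by (rule bounded_subset) auto
  then obtain l' s where s: "strict_mono s" "((x \<circ> r) \<circ> s) \<longlonglongrightarrow> l'"
    using bounded_imp_convergent_subsequence by blast
  have "(x \<circ> (r \<circ> s)) \<longlonglongrightarrow> l"
    using assms(2)[of "r \<circ> s" l'] s r(1) by (simp add: strict_mono_o comp_assoc)
  then obtain n where "dist (x (r (s n))) l < e"
    using \<open>e > 0\<close> unfolding lim_sequentially comp_def by blast
  with r(2)[of "s n"] show False by simp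
qed

text \<open>By continuity every accumulation point has value \<open>L\<close>, hence is a minimizer,
  and boundedness supplies one. A unique minimizer is then the only accumulation point.\<close>

lemma minimizing_sequence_accumulates:
  fixes f :: "'a::heine_borel \<Rightarrow> real" and x :: "nat \<Rightarrow> 'a"
  assumes f: "continuous_on UNIV f" and x: "bounded (range x)"
    and L: "(\<lambda>n. f (x n)) \<longlonglongrightarrow> L" "\<And>y. L \<le> f y"
  shows "\<exists>xbar. (\<forall>y. f xbar \<le> f y)
    \<and> (\<lambda>n. f (x n)) \<longlonglongrightarrow> f xbar
    \<and> (\<forall>xhat. (\<exists>r. strict_mono r \<and> (x \<circ> r) \<longlonglongrightarrow> xhat) \<longrightarrow> f xhat = f xbar)
    \<and> ((\<forall>z. (\<forall>y. f z \<le> f y) \<longrightarrow> z = xbar) \<longrightarrow> x \<longlonglongrightarrow> xbar)"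
proof -
  have acc: "f xhat = L" if "strict_mono r" "(x \<circ> r) \<longlonglongrightarrow> xhat" for r xhat
  proof -
    have "(\<lambda>n. f ((x \<circ> r) n)) \<longlonglongrightarrow> f xhat"
      using continuous_on_tendsto_compose[OF f that(2)] by simp
    moreover have "(\<lambda>n. f ((x \<circ> r) n)) \<longlonglongrightarrow> L"
      using LIMSEQ_subseq_LIMSEQ[OF L(1) that(1)] by (simp add: comp_def)
    ultimately show ?thesis by (rule LIMSEQ_unique)
  qed
  obtain xbar r where "strict_mono r" "(x \<circ> r) \<longlonglongrightarrow> xbar"
    using bounded_imp_convergent_subsequence[OF x] by blast
  then have xbar: "f xbar = L" by (rule acc)
  have "x \<longlonglongrightarrow> xbar" if "\<forall>z. (\<forall>y. f z \<le> f y) \<longrightarrow> z = xbar"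
    using x by (rule bounded_seq_tendsto_unique_accumulation_point) (use that acc L(2) in auto)
  then show ?thesis using xbar L acc by (intro exI[of _ xbar]) auto
qed

section \<open>The smoothed objective along one IRLS step\<close>

definition smoothed_objective ::
    "real ^ 'n ^ 'm \<Rightarrow> real ^ 'm \<Rightarrow> real ^ 'n \<Rightarrow> real ^ 'n \<Rightarrow> real \<Rightarrow> real ^ 'n \<Rightarrow> real"
  where "smoothed_objective A b q lam e x =
    (norm (A *v x - b))\<^sup>2 + 2 * (\<Sum>k\<in>UNIV. lam $ k * smoothed_abs_powr (q $ k) e (x $ k))"

text \<open>Exact second-order expansion of the quadratic. The linear term is written in coordinates
  so that it combines with the separable penalty.\<close>

lemma norm_residual_sq_expand:
  fixes A :: "real ^ 'n ^ 'm"
  shows "(norm (A *v y - b))\<^sup>2 = (norm (A *v x - b))\<^sup>2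
    + 2 * (\<Sum>k\<in>UNIV. (transpose A *v (A *v x - b)) $ k * (y $ k - x $ k))
    + (norm (A *v (y - x)))\<^sup>2"
proof -
  have "(A *v x - b) \<bullet> (A *v (y - x))
      = (\<Sum>k\<in>UNIV. (transpose A *v (A *v x - b)) $ k * (y $ k - x $ k))"
    by (simp only: transpose_matrix_vector dot_lmul_matrix[symmetric])
      (simp add: inner_vec_def)
  moreover have "A *v y - b = (A *v x - b) + A *v (y - x)"
    by (simp add: matrix_vector_mult_diff_distrib)
  moreover have "(norm (u + v))\<^sup>2 = (norm u)\<^sup>2 + 2 * (u \<bullet> v) + (norm v)\<^sup>2" for u v :: "real ^ 'm"
    by (simp add: power2_norm_eq_inner inner_add_left inner_add_right inner_commute)
  ultimately show ?thesis by presburger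
qed

text \<open>In this form the weight is recognizable as the slope factor of the majorant and tangent
  bounds.\<close>

lemma irls_weight_eq: "irls_weight q e x k = ((x $ k)\<^sup>2 + e\<^sup>2) powr (q $ k / 2 - 1)"
proof -
  have "(2 - q $ k) / 2 = - (q $ k / 2 - 1)" by (simp add: field_simps)
  then show ?thesis by (simp only: irls_weight_def powr_minus_divide) simp
qed

text \<open>Clearing the positive denominator of the step expresses half the gradient of the
  quadratic term through the old and the new iterate.\<close>

lemma irls_step_stationary:
  assumes "0 \<le> q $ k" "0 \<le> lam $ k"
  shows "(transpose A *v (A *v x - b)) $ k = x $ k
    - (1 + lam $ k * q $ k * irls_weight q e x k) * irls_step A b q lam e x $ k"
proof -
  have "0 \<le> lam $ k * q $ k * irls_weight q e x k"
    using assms by (simp add: irls_weight_def)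
  then have "1 + lam $ k * q $ k * irls_weight q e x k \<noteq> 0" by linarith
  then show ?thesis
    by (simp add: irls_step_def matrix_vector_mult_diff_distrib)
qed

lemma irls_step_descent:
  fixes A :: "real ^ 'n ^ 'm" and b :: "real ^ 'm" and q lam x :: "real ^ 'n"
  assumes A: "onorm ((*v) A) \<le> 1"
    and q: "\<And>k. 0 \<le> q $ k" "\<And>k. q $ k \<le> 2" and lam: "\<And>k. 0 \<le> lam $ k"
    and e: "0 < e'" "e' \<le> e"
  defines "y \<equiv> irls_step A b q lam e x"
  shows "smoothed_objective A b q lam e' y + (norm (y - x))\<^sup>2 \<le> smoothed_objective A b q lam e x"
proof -
  define g where "g = transpose A *v (A *v x - b)"
  define w where "w = irls_weight q e x"
  define h where "h e y k = lam $ k * smoothed_abs_powr (q $ k) e (y $ k)" for e and y :: "real ^ 'n" and k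
  have "norm (A *v (y - x)) \<le> onorm ((*v) A) * norm (y - x)"
    by (rule onorm) simp
  also have "\<dots> \<le> 1 * norm (y - x)" using A by (intro mult_right_mono) auto
  finally have quad: "(norm (A *v (y - x)))\<^sup>2 \<le> (norm (y - x))\<^sup>2" by (simp add: power_mono)
  have norm_sum: "(norm (y - x))\<^sup>2 = (\<Sum>k\<in>UNIV. (y $ k - x $ k)\<^sup>2)"
    unfolding power2_norm_eq_inner by (simp add: inner_vec_def power2_eq_square)
  \<comment> \<open>Of the two copies of the squared step, one pays for the quadratic remainder
    \<open>quad\<close>; the other is the claimed decrease.\<close>
  have "2 * g $ k * (y $ k - x $ k) + 2 * h e' y k + 2 * (y $ k - x $ k)\<^sup>2 \<le> 2 * h e x k" for k
  proof -
    define c where "c = lam $ k * q $ k * w k"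
    have c: "0 \<le> c" using q lam by (simp add: c_def w_def irls_weight_def)
    have "lam $ k * (2 * smoothed_abs_powr (q $ k) e' (y $ k))
        \<le> lam $ k * (2 * smoothed_abs_powr (q $ k) e (x $ k)
            + q $ k * w k * ((y $ k)\<^sup>2 - (x $ k)\<^sup>2))"
      unfolding w_def irls_weight_eq using q lam e
      by (intro mult_left_mono smoothed_abs_powr_majorant) auto
    then have "2 * h e' y k \<le> 2 * h e x k + c * ((y $ k)\<^sup>2 - (x $ k)\<^sup>2)"
      by (simp add: h_def c_def algebra_simps)
    moreover have g_k: "g $ k = x $ k - (1 + c) * y $ k"
      unfolding g_def c_def w_def y_def using q lam by (intro irls_step_stationary)
    then have "2 * g $ k * (y $ k - x $ k) + c * ((y $ k)\<^sup>2 - (x $ k)\<^sup>2) + 2 * (y $ k - x $ k)\<^sup>2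
        = - (c * (y $ k - x $ k)\<^sup>2)"
      unfolding g_k by (simp add: power2_eq_square algebra_simps)
    moreover have "0 \<le> c * (y $ k - x $ k)\<^sup>2" using c by simp
    ultimately show ?thesis by linarith
  qed
  then have "(\<Sum>k\<in>UNIV. 2 * g $ k * (y $ k - x $ k) + 2 * h e' y k + 2 * (y $ k - x $ k)\<^sup>2)
      \<le> (\<Sum>k\<in>UNIV. 2 * h e x k)"
    by (rule sum_mono)
  then have "2 * (\<Sum>k\<in>UNIV. g $ k * (y $ k - x $ k)) + 2 * (\<Sum>k\<in>UNIV. h e' y k) + 2 * (norm (y - x))\<^sup>2
      \<le> 2 * (\<Sum>k\<in>UNIV. h e x k)"
    by (simp add: sum.distrib norm_sum sum_distrib_left mult.assoc)
  then show ?thesis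
    using quad norm_residual_sq_expand[of A y b x]
    unfolding smoothed_objective_def g_def h_def by linarith
qed

text \<open>Convexity bounds the excess over the value at \<open>z\<close> by gradient times
  distance. With \<open>c\<close> = \<open>lam $ k * q $ k * w k\<close>, half the gradient at
  \<open>x\<close> has components -(1 + c) (y_k - x_k), and 1 + c is O(1/e).\<close>

lemma irls_step_near_optimal:
  fixes A :: "real ^ 'n ^ 'm" and b :: "real ^ 'm" and q lam x :: "real ^ 'n"
  assumes q: "\<And>k. 1 \<le> q $ k" "\<And>k. q $ k \<le> 2" and lam: "\<And>k. 0 \<le> lam $ k"
    and e: "0 < e" "e \<le> 1"
  defines "y \<equiv> irls_step A b q lam e x"
  shows "smoothed_objective A b q lam e x \<le> smoothed_objective A b q lam e z
    + 2 * (\<Sum>k\<in>UNIV. 1 + 2 * lam $ k) * norm (z - x) * (norm (y - x) / e)"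
proof -
  define g where "g = transpose A *v (A *v x - b)"
  define w where "w = irls_weight q e x"
  define h where "h y k = lam $ k * smoothed_abs_powr (q $ k) e (y $ k)" for y :: "real ^ 'n" and k
  define R where "R = norm (z - x) * (norm (y - x) / e)"
  have "2 * h x k \<le> 2 * g $ k * (z $ k - x $ k) + 2 * h z k + 2 * ((1 + 2 * lam $ k) * R)" for k
  proof -
    define c where "c = lam $ k * q $ k * w k"
    have c: "0 \<le> c"
      using q(1)[of k] lam[of k] by (simp add: c_def w_def irls_weight_def)
    \<comment> \<open>The exponent is nonpositive, so the weight is largest where the coordinate
      vanishes; then \<open>q $ k \<ge> 1\<close> and \<open>e \<le> 1\<close> give 1/e.\<close>
    have "w k \<le> (e\<^sup>2) powr (q $ k / 2 - 1)"
      unfolding w_def irls_weight_eq using e q(2)[of k] by (intro powr_mono2') auto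
    also have "\<dots> = e powr (q $ k - 2)"
      using e by (simp add: powr_powr flip: powr_numeral)
    also have "\<dots> \<le> e powr (- 1)"
      using e q(1)[of k] by (intro powr_mono') auto
    also have "\<dots> = 1 / e" using e by (simp add: powr_minus_divide)
    finally have w: "w k \<le> 1 / e" .
    have "c \<le> lam $ k * 2 * (1 / e)"
      unfolding c_def using w lam[of k] q(1)[of k] q(2)[of k]
      by (intro mult_mono mult_nonneg_nonneg) (auto simp: w_def irls_weight_def)
    \<comment> \<open>Absorbs the summand 1 of 1 + c into a multiple of 1/e.\<close>
    moreover have "1 \<le> 1 / e" using e by simp
    ultimately have "1 + c \<le> 1 / e + lam $ k * 2 * (1 / e)" by linarith
    then have c_le: "1 + c \<le> (1 + 2 * lam $ k) * (1 / e)"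
      by (simp add: algebra_simps)
    have "\<bar>(1 + c) * (y $ k - x $ k) * (z $ k - x $ k)\<bar>
        \<le> (1 + 2 * lam $ k) * (1 / e) * norm (y - x) * norm (z - x)"
      unfolding abs_mult
      using c c_le lam[of k] e component_le_norm_cart[of "y - x" k] component_le_norm_cart[of "z - x" k]
      by (intro mult_mono) auto
    also have "\<dots> = (1 + 2 * lam $ k) * R" by (simp add: R_def)
    finally have "(1 + c) * (y $ k - x $ k) * (z $ k - x $ k) \<le> (1 + 2 * lam $ k) * R" by linarith
    moreover have "lam $ k * (smoothed_abs_powr (q $ k) e (x $ k)
          + q $ k * w k * x $ k * (z $ k - x $ k))
        \<le> lam $ k * smoothed_abs_powr (q $ k) e (z $ k)"
      unfolding w_def irls_weight_eq using q lam e
      by (intro mult_left_mono smoothed_abs_powr_tangent) auto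
    then have "h x k + c * x $ k * (z $ k - x $ k) \<le> h z k"
      by (simp add: h_def c_def algebra_simps)
    moreover have g_k: "g $ k = x $ k - (1 + c) * y $ k"
      unfolding g_def c_def w_def y_def using q(1)[of k] lam by (intro irls_step_stationary) auto
    then have "g $ k * (z $ k - x $ k) + c * x $ k * (z $ k - x $ k)
        = - ((1 + c) * (y $ k - x $ k) * (z $ k - x $ k))"
      unfolding g_k by (simp add: algebra_simps)
    ultimately show ?thesis by linarith
  qed
  then have "(\<Sum>k\<in>UNIV. 2 * h x k)
      \<le> (\<Sum>k\<in>UNIV. 2 * g $ k * (z $ k - x $ k) + 2 * h z k + 2 * ((1 + 2 * lam $ k) * R))"
    by (rule sum_mono)
  also have "\<dots> = 2 * (\<Sum>k\<in>UNIV. g $ k * (z $ k - x $ k)) + 2 * (\<Sum>k\<in>UNIV. h z k)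
      + 2 * ((\<Sum>k\<in>UNIV. 1 + 2 * lam $ k) * R)"
    unfolding sum_distrib_right sum_distrib_left sum.distrib[symmetric] by (simp add: mult.assoc)
  finally have "2 * (\<Sum>k\<in>UNIV. h x k) \<le> \<dots>" by (simp only: sum_distrib_left)
  \<comment> \<open>The remainder \<open>(norm (A *v (z - x)))\<^sup>2\<close> of the expansion is
    nonnegative and is discarded.\<close>
  then show ?thesis
    using norm_residual_sq_expand[of A z b x]
    unfolding smoothed_objective_def g_def h_def R_def mult.assoc
    by (smt (verit) zero_le_power2)
qed

section \<open>Smoothing error, coercivity and continuity of the objective\<close>

lemma irls_objective_le_smoothed:
  assumes "\<And>k. 0 \<le> q $ k" "\<And>k. 0 \<le> lam $ k"
  shows "irls_objective A b q lam x \<le> smoothed_objective A b q lam e x"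
  unfolding irls_objective_def smoothed_objective_def using assms
  by (intro add_left_mono mult_left_mono sum_mono abs_powr_le_smoothed) auto

text \<open>Subadditivity of u^(q/2) makes the smoothing error uniform in \<open>x\<close>.\<close>

lemma smoothed_objective_le:
  assumes "\<And>k. 0 \<le> q $ k" "\<And>k. q $ k \<le> 2" "\<And>k. 0 \<le> lam $ k"
  shows "smoothed_objective A b q lam e x
    \<le> irls_objective A b q lam x + 2 * (\<Sum>k\<in>UNIV. lam $ k * \<bar>e\<bar> powr (q $ k))"
proof -
  have "(\<Sum>k\<in>UNIV. lam $ k * smoothed_abs_powr (q $ k) e (x $ k))
      \<le> (\<Sum>k\<in>UNIV. lam $ k * (\<bar>x $ k\<bar> powr (q $ k) + \<bar>e\<bar> powr (q $ k)))"
    using assms by (intro sum_mono mult_left_mono smoothed_le_abs_powr) auto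
  then show ?thesis
    by (simp add: irls_objective_def smoothed_objective_def distrib_left sum.distrib)
qed

text \<open>All terms of the objective are nonnegative, so each weighted power is at most
  \<open>C\<close>; and |t| \<le> 1 + |t|^r for r \<ge> 1 turns this into a bound on the
  coordinate.\<close>

lemma bounded_irls_objective_sublevel:
  assumes q: "\<And>k. 1 \<le> q $ k" and lam: "\<And>k. lam $ k > 0"
  shows "bounded {x. irls_objective A b q lam x \<le> C}"
proof (rule boundedI)
  fix x :: "real ^ 'a"
  assume "x \<in> {x. irls_objective A b q lam x \<le> C}"
  then have C: "irls_objective A b q lam x \<le> C" by simp
  have "\<bar>x $ k\<bar> \<le> 1 + C / lam $ k" for k
  proof -
    have "\<bar>x $ k\<bar> \<le> 1 + \<bar>x $ k\<bar> powr (q $ k)"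
    proof (cases "\<bar>x $ k\<bar> \<le> 1")
      case False
      then show ?thesis using powr_mono[of 1 "q $ k" "\<bar>x $ k\<bar>"] q[of k] by simp
    qed (simp add: add_increasing2)
    moreover have "lam $ k * \<bar>x $ k\<bar> powr (q $ k) \<le> (\<Sum>k\<in>UNIV. lam $ k * \<bar>x $ k\<bar> powr (q $ k))"
      using lam by (intro member_le_sum mult_nonneg_nonneg) (auto intro: less_imp_le)
    moreover have "0 \<le> (\<Sum>k\<in>UNIV. lam $ k * \<bar>x $ k\<bar> powr (q $ k))"
      using lam by (intro sum_nonneg mult_nonneg_nonneg) (auto intro: less_imp_le)
    ultimately have "lam $ k * \<bar>x $ k\<bar> powr (q $ k) \<le> C"
      using C zero_le_power2[of "norm (A *v x - b)"] unfolding irls_objective_def by linarith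
    then have "\<bar>x $ k\<bar> powr (q $ k) \<le> C / lam $ k"
      using lam[of k] by (simp add: field_simps)
    with \<open>\<bar>x $ k\<bar> \<le> 1 + _\<close> show ?thesis by linarith
  qed
  then have "(\<Sum>k\<in>UNIV. \<bar>x $ k\<bar>) \<le> (\<Sum>k\<in>UNIV. 1 + C / lam $ k)"
    by (intro sum_mono)
  then show "norm x \<le> (\<Sum>k\<in>UNIV. 1 + C / lam $ k)"
    using norm_le_l1_cart[of x] by linarith
qed

lemma continuous_on_irls_objective:
  fixes A :: "real ^ 'n ^ 'm"
  assumes "\<And>k. 0 < q $ k"
  shows "continuous_on UNIV (irls_objective A b q lam)"
  unfolding irls_objective_def using assms
  by (intro continuous_intros continuous_on_powr') (auto intro: linear_continuous_on)

section \<open>Step lengths against smoothing parameters\<close>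

text \<open>If the step lengths \<open>\<delta>\<close> were eventually at least \<open>c\<close> times the smoothing parameters, then
  \<open>sqrt (\<delta> n) \<ge> sqrt (c * \<epsilon> n) \<ge> \<epsilon> n\<close> as soon as \<open>\<epsilon> n \<le> c\<close>, so \<open>\<epsilon>\<close> would never decrease again.\<close>

lemma frequently_step_less_smoothing:
  fixes \<epsilon> \<delta> a :: "nat \<Rightarrow> real"
  assumes rec: "\<And>n. \<epsilon> (Suc n) = min (\<epsilon> n) (sqrt (\<delta> n + a n))"
    and pos: "\<And>n. 0 < \<epsilon> n" and a: "\<And>n. 0 \<le> a n" and lim: "\<epsilon> \<longlonglongrightarrow> 0" and c: "0 < c"
  shows "\<exists>\<^sub>F n in sequentially. \<delta> n < c * \<epsilon> n"
proof (rule ccontr)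
  assume "\<not> ?thesis"
  then have "\<forall>\<^sub>F n in sequentially. c * \<epsilon> n \<le> \<delta> n"
    by (simp add: not_frequently not_less)
  moreover have "\<forall>\<^sub>F n in sequentially. \<epsilon> n < c"
    using lim c by (rule order_tendstoD)
  ultimately have "\<forall>\<^sub>F n in sequentially. \<epsilon> (Suc n) = \<epsilon> n"
  proof eventually_elim
    case (elim n)
    have "\<epsilon> n * \<epsilon> n \<le> c * \<epsilon> n" using elim pos[of n] by (intro mult_right_mono) auto
    then have "(\<epsilon> n)\<^sup>2 \<le> \<delta> n + a n" using elim a[of n] by (simp add: power2_eq_square)
    then have "\<epsilon> n \<le> sqrt (\<delta> n + a n)" by (rule real_le_rsqrt)
    then show ?case by (simp add: rec)
  qed
  then obtain N where N: "\<And>n. n \<ge> N \<Longrightarrow> \<epsilon> (Suc n) = \<epsilon> n"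
    by (auto simp: eventually_sequentially)
  have "\<epsilon> n = \<epsilon> N" if "n \<ge> N" for n
    using that by (induction n rule: dec_induct) (simp_all add: N)
  then have "\<forall>\<^sub>F n in sequentially. \<epsilon> n = \<epsilon> N"
    by (rule eventually_sequentiallyI)
  then have "\<epsilon> \<longlonglongrightarrow> \<epsilon> N" by (rule tendsto_eventually)
  with lim have "\<epsilon> N = 0" by (metis LIMSEQ_unique)
  with pos[of N] show False by simp
qed

section \<open>Convergence of the IRLS iterates\<close>

theorem mainTheorem1:
  fixes A :: "real ^ 'n ^ 'm" and b :: "real ^ 'm"
    and q lam x0 :: "real ^ 'n" and e0 \<alpha> :: real
    and F :: "real ^ 'n \<Rightarrow> real" and x :: "nat \<Rightarrow> real ^ 'n"
  assumes "onorm ((*v) A) < 1"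
    and "\<And>k. 1 \<le> q $ k" and "\<And>k. q $ k \<le> 2"
    and "\<And>k. lam $ k > 0"
    and "e0 > 0" and "0 < \<alpha>" and "\<alpha> < 1"
  defines "F \<equiv> irls_objective A b q lam"
    and "x \<equiv> irls_iterate A b q lam x0 e0 \<alpha>"
  shows "\<exists>xbar. (\<forall>y. F xbar \<le> F y)
    \<and> (\<lambda>n. F (x n)) \<longlonglongrightarrow> F xbar
    \<and> (\<forall>xhat. (\<exists>r. strict_mono r \<and> (x \<circ> r) \<longlonglongrightarrow> xhat) \<longrightarrow> F xhat = F xbar)
    \<and> ((\<forall>z. (\<forall>y. F z \<le> F y) \<longrightarrow> z = xbar) \<longrightarrow> x \<longlonglongrightarrow> xbar)"
proof -
  note q = assms(2,3) and lam = assms(4)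
  have q0: "0 < q $ k" and lam0: "0 \<le> lam $ k" for k
    using q(1)[of k] lam[of k] by auto
  define \<epsilon> where "\<epsilon> = irls_eps A b q lam x0 e0 \<alpha>"
  define \<delta> where "\<delta> n = norm (x (Suc n) - x n)" for n
  define \<Phi> where "\<Phi> n = smoothed_objective A b q lam (\<epsilon> n) (x n)" for n
  \<comment> \<open>Uniform bound for the excess of the \<open>n\<close>-th smoothed objective over
    \<open>F\<close>.\<close>
  define gap where "gap n = 2 * (\<Sum>k\<in>UNIV. lam $ k * \<bar>\<epsilon> n\<bar> powr (q $ k))" for n
  have x_Suc: "x (Suc n) = irls_step A b q lam (\<epsilon> n) (x n)" for n
    by (simp add: x_def \<epsilon>_def irls_iterate_Suc)
  have eps_Suc: "\<epsilon> (Suc n) = min (\<epsilon> n) (sqrt (\<delta> n + \<alpha> ^ Suc n))" for n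
    by (simp add: x_def \<epsilon>_def \<delta>_def irls_eps_Suc)
  have eps_le: "\<epsilon> (Suc n) \<le> \<epsilon> n" for n
    by (simp add: eps_Suc)
  \<comment> \<open>The power of \<alpha> keeps the parameter positive even after a step of length
    zero.\<close>
  have eps_pos: "0 < \<epsilon> n" for n
  proof (induction n)
    case 0
    show ?case using \<open>e0 > 0\<close> by (simp add: \<epsilon>_def irls_eps_0)
  next
    case (Suc n)
    then show ?case using \<open>0 < \<alpha>\<close> by (simp add: eps_Suc \<delta>_def add_nonneg_pos)
  qed

  have descent: "\<Phi> (Suc n) + (\<delta> n)\<^sup>2 \<le> \<Phi> n" for n
    unfolding \<Phi>_def \<delta>_def x_Suc using assms(1) q q0 lam0 eps_pos eps_le
    by (intro irls_step_descent) (auto intro: less_imp_le)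
  have "decseq \<Phi>"
  proof (rule decseq_SucI)
    show "\<Phi> (Suc n) \<le> \<Phi> n" for n
      using descent[of n] zero_le_power2[of "\<delta> n"] by linarith
  qed
  have F_le: "F y \<le> smoothed_objective A b q lam (\<epsilon> n) y" for n y
    unfolding F_def using q0 lam0 by (intro irls_objective_le_smoothed) (auto intro: less_imp_le)
  have le_F: "smoothed_objective A b q lam (\<epsilon> n) y \<le> F y + gap n" for n y
    unfolding F_def gap_def using q q0 lam0 by (intro smoothed_objective_le) (auto intro: less_imp_le)
  have "0 \<le> F y" for y
    unfolding F_def irls_objective_def using lam0 by (auto intro!: add_nonneg_nonneg sum_nonneg)
  then have "0 \<le> \<Phi> n" for n
    using F_le[of "x n" n] unfolding \<Phi>_def by (meson order_trans)
  then obtain L where L: "\<Phi> \<longlonglongrightarrow> L" and L_le: "\<And>n. L \<le> \<Phi> n"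
    using decseq_convergent[OF \<open>decseq \<Phi>\<close>] by metis

  \<comment> \<open>The squared steps are dominated by successive differences of the convergent
    sequence \<open>\<Phi>\<close>.\<close>
  have "(\<lambda>n. (\<delta> n)\<^sup>2) \<longlonglongrightarrow> 0"
  proof (rule Lim_null_comparison)
    show "(\<lambda>n. \<Phi> n - \<Phi> (Suc n)) \<longlonglongrightarrow> 0"
      using tendsto_diff[OF L LIMSEQ_Suc[OF L]] by simp
    show "\<forall>\<^sub>F n in sequentially. norm ((\<delta> n)\<^sup>2) \<le> \<Phi> n - \<Phi> (Suc n)"
      using descent by (auto simp: algebra_simps)
  qed
  then have \<delta>: "\<delta> \<longlonglongrightarrow> 0" by simp
  have "\<epsilon> \<longlonglongrightarrow> 0"
  proof (rule LIMSEQ_imp_Suc, rule Lim_null_comparison)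
    have "(\<lambda>n. \<alpha> ^ Suc n) \<longlonglongrightarrow> 0"
      using \<open>0 < \<alpha>\<close> \<open>\<alpha> < 1\<close> by (intro LIMSEQ_Suc LIMSEQ_power_zero) auto
    from tendsto_real_sqrt[OF tendsto_add[OF \<delta> this]]
    show "(\<lambda>n. sqrt (\<delta> n + \<alpha> ^ Suc n)) \<longlonglongrightarrow> 0" by simp
    show "\<forall>\<^sub>F n in sequentially. norm (\<epsilon> (Suc n)) \<le> sqrt (\<delta> n + \<alpha> ^ Suc n)"
      using eps_pos by (simp add: abs_of_pos) (simp add: eps_Suc)
  qed
  have "((\<lambda>n. \<bar>\<epsilon> n\<bar> powr (q $ k)) \<longlonglongrightarrow> 0)" for k
    using tendsto_powr2[OF tendsto_rabs_zero[OF \<open>\<epsilon> \<longlonglongrightarrow> 0\<close>] tendsto_const[of "q $ k"]] q0[of k]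
    by simp
  then have "(\<lambda>n. 2 * (\<Sum>k\<in>UNIV. lam $ k * \<bar>\<epsilon> n\<bar> powr (q $ k))) \<longlonglongrightarrow> 2 * (\<Sum>k\<in>UNIV. lam $ k * 0)"
    by (intro tendsto_intros)
  then have gap: "gap \<longlonglongrightarrow> 0" by (simp add: gap_def[abs_def])
  \<comment> \<open>\<open>F (x n)\<close> is squeezed between \<open>\<Phi> n - gap n\<close> and
    \<open>\<Phi> n\<close>.\<close>
  have F_lim: "(\<lambda>n. F (x n)) \<longlonglongrightarrow> L"
  proof (rule tendsto_sandwich[where h = \<Phi>])
    show "(\<lambda>n. \<Phi> n - gap n) \<longlonglongrightarrow> L" using tendsto_diff[OF L gap] by simp
    show "\<forall>\<^sub>F n in sequentially. \<Phi> n - gap n \<le> F (x n)"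
      using le_F[of _ "x _"] by (auto simp: \<Phi>_def algebra_simps)
    show "\<forall>\<^sub>F n in sequentially. F (x n) \<le> \<Phi> n" using F_le by (auto simp: \<Phi>_def)
  qed (rule L)

  have "F (x n) \<le> \<Phi> 0" for n
    using F_le[of "x n" n] decseqD[OF \<open>decseq \<Phi>\<close>, of 0 n] by (simp add: \<Phi>_def)
  then have "range x \<subseteq> {y. F y \<le> \<Phi> 0}" by auto
  then have bdd: "bounded (range x)"
    using bounded_irls_objective_sublevel[OF q(1) lam] unfolding F_def by (rule bounded_subset[rotated])
  then obtain R where R: "\<And>n. norm (x n) \<le> R" unfolding bounded_iff by auto

  have "L \<le> F z" for z
  proof (rule field_le_epsilon)
    fix \<eta> :: real
    assume "\<eta> > 0"
    \<comment> \<open>Bounds the factor of \<open>\<delta> n / \<epsilon> n\<close> in the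
      near-optimality estimate, using the bound \<open>R\<close> on the iterates. Half of
      \<open>\<eta>\<close> goes to this estimate, half to \<open>gap n\<close>.\<close>
    define K where "K = 2 * (\<Sum>k\<in>UNIV. 1 + 2 * lam $ k) * (norm z + R)"
    have "0 \<le> R" using R[of 0] norm_ge_zero[of "x 0"] by linarith
    then have K: "0 \<le> K" unfolding K_def using lam0
      by (intro mult_nonneg_nonneg sum_nonneg add_nonneg_nonneg) auto
    have "0 < \<eta> / 2" using \<open>\<eta> > 0\<close> by simp
    then have "\<forall>\<^sub>F n in sequentially. \<epsilon> n < 1 \<and> gap n < \<eta> / 2"
      using \<open>\<epsilon> \<longlonglongrightarrow> 0\<close> gap by (intro eventually_conj order_tendstoD(2)) auto
    \<comment> \<open>Dividing by \<open>K + 1\<close> instead of \<open>K\<close> also covers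
      \<open>K = 0\<close>. A single good index suffices, since \<open>L \<le> \<Phi> n\<close> for
      every \<open>n\<close>.\<close>
    moreover have "\<exists>\<^sub>F n in sequentially. \<delta> n < \<eta> / (2 * (K + 1)) * \<epsilon> n"
      by (rule frequently_step_less_smoothing[OF eps_Suc eps_pos _ \<open>\<epsilon> \<longlonglongrightarrow> 0\<close>])
        (use \<open>\<eta> > 0\<close> \<open>0 < \<alpha>\<close> K in auto)
    ultimately obtain n where n: "\<epsilon> n < 1" "gap n < \<eta> / 2" "\<delta> n < \<eta> / (2 * (K + 1)) * \<epsilon> n"
      using frequently_ex[OF frequently_eventually_frequently] by blast
    have "norm (z - x n) \<le> norm z + R"
      using norm_triangle_ineq4[of z "x n"] R[of n] by linarith
    then have "2 * (\<Sum>k\<in>UNIV. 1 + 2 * lam $ k) * norm (z - x n) * (\<delta> n / \<epsilon> n) \<le> K * (\<delta> n / \<epsilon> n)"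
      unfolding K_def using lam0 eps_pos[of n]
      by (intro mult_right_mono mult_left_mono mult_nonneg_nonneg sum_nonneg) (auto simp: \<delta>_def)
    also have "\<dots> \<le> K * (\<eta> / (2 * (K + 1)))"
      using n(3) eps_pos[of n] K by (intro mult_left_mono) (auto simp: pos_divide_le_eq)
    also have "\<dots> \<le> \<eta> / 2"
      using K \<open>\<eta> > 0\<close> by (simp add: field_simps)
    finally have "\<Phi> n \<le> smoothed_objective A b q lam (\<epsilon> n) z + \<eta> / 2"
      using irls_step_near_optimal[of q lam "\<epsilon> n" A b "x n" z] q lam0 eps_pos[of n] n(1)
      by (simp add: \<Phi>_def \<delta>_def x_Suc)
    then show "L \<le> F z + \<eta>" using L_le[of n] le_F[of n z] n(2) by linarith
  qed
  moreover have "continuous_on UNIV F"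
    unfolding F_def using q0 by (rule continuous_on_irls_objective)
  ultimately show ?thesis using bdd F_lim by (intro minimizing_sequence_accumulates)
qed

end
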